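(* Let $G$ be a finite group that is a split extension over an abelian subgroup $N$ (that is, $N$ is an abelian normal subgroup of $G$ that has a complement in $G$). Suppose that for each prime $p$ there is a Sylow $p$-subgroup $S$ of $G$ such that any two complements of $N\cap S$ in $S$ are conjugate in $G$. Then any two complements of $N$ in $G$ are conjugate in $G$.
   Context: For a group $X$ and a normal subgroup $M$ of $X$, a complement of $M$ in $X$ is a subgroup $K\leq X$ with $X=MK$ and $M\cap K=1$. *)

theory Defs
  imports "HOL-Algebra.Sylow"
begin

(* Meant for a normal subgroup M of H. Complements in a subgroup S of G are obtained by
   taking H = G\<lparr>carrier := S\<rparr>. *)
definition complement :: "('a, 'b) monoid_scheme \<Rightarrow> 'a set \<Rightarrow> 'a set \<Rightarrow> bool" where
  "complement H M K \<longleftrightarrow>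
     subgroup K H \<and> carrier H = M <#>\<^bsub>H\<^esub> K \<and> M \<inter> K = {\<one>\<^bsub>H\<^esub>}"

definition conjugate_in :: "('a, 'b) monoid_scheme \<Rightarrow> 'a set \<Rightarrow> 'a set \<Rightarrow> bool" where
  "conjugate_in G H K \<longleftrightarrow> (\<exists>g \<in> carrier G. K = (g <#\<^bsub>G\<^esub> H) #>\<^bsub>G\<^esub> inv\<^bsub>G\<^esub> g)"

(* Meant for finite G and prime p. If p does not divide the order of G, the Sylow
   p-subgroup is trivial. *)
definition sylow_subgroup :: "('a, 'b) monoid_scheme \<Rightarrow> nat \<Rightarrow> 'a set \<Rightarrow> bool" where
  "sylow_subgroup G p S \<longleftrightarrow> subgroup S G \<and> card S = p ^ multiplicity p (order G)"

end

theory Submission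
  imports Defs "HOL-Algebra.SndIsomorphismGrp" "HOL-Algebra.Multiplicative_Group"
begin

text \<open>
  The proof is the classical restriction argument for the first cohomology group, carried out with
  explicit crossed homomorphisms.  Projecting \<open>G\<close> to \<open>N\<close> along a complement \<open>K\<close> gives a crossed
  homomorphism \<open>f : G \<rightarrow> N\<close> that is the identity on \<open>N\<close> and has kernel \<open>K\<close> (lemma
  \<open>complement_is_kernel\<close>).  If \<open>g\<close> belongs to \<open>L\<close> in the same way, then \<open>K\<close> and \<open>L\<close> are conjugate
  as soon as the quotient \<open>d = f g\<inverse>\<close> is principal (lemma \<open>conjugate_kernels\<close>).  The set of exponents
  \<open>m\<close> for which \<open>d\<^sup>m\<close> is principal is closed under differences, so it is enough to find in it, for every prime \<open>p\<close>, an exponent prime to \<open>p\<close>.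

  Fix \<open>p\<close> and the given Sylow subgroup \<open>S\<close>.  The subgroups \<open>K \<inter> S\<close> and \<open>L \<inter> S\<close> need not be complements of
  \<open>N \<inter> S\<close> in \<open>S\<close>.  However, there is an exponent \<open>e\<close> prime to \<open>p\<close> such that \<open>n \<mapsto> n\<^sup>e\<close> is a projection
  of \<open>N\<close> onto \<open>N \<inter> S\<close> (lemma \<open>sylow_power_projection\<close>), and then the kernels \<open>C\<close>, \<open>D\<close> of \<open>f\<^sup>e\<close> and
  \<open>g\<^sup>e\<close> on \<open>S\<close> are such complements (lemma \<open>complement_kernel\<close>).  By hypothesis \<open>D = c C c\<inverse>\<close> for
  some \<open>c\<close> in \<open>G\<close>.  It does no harm that \<open>c\<close> may lie outside \<open>S\<close>: since \<open>f\<^sup>e\<close> is defined on all of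
  \<open>G\<close>, vanishing on \<open>C\<close> makes it principal on the conjugate \<open>D\<close> (lemma \<open>crossed_hom_conjugate\<close>).
  Hence \<open>d\<^sup>e\<close> agrees on \<open>D\<close> with a principal crossed homomorphism \<open>q\<close>.  Both are trivial on \<open>N\<close>, so
  they agree on a subgroup containing \<open>(N \<inter> S) D = S\<close>, whose index \<open>i\<close> is therefore prime to \<open>p\<close>.
  Multiplying the values of \<open>d\<^sup>e q\<inverse>\<close> over the cosets of that subgroup shows that its \<open>i\<close>-th power
  is principal (lemma \<open>principal_pow_card_image\<close>), and so \<open>d\<close> to the power \<open>e i\<close> is principal.
\<close>

section \<open>A criterion for a set of exponents to contain one\<close>

text \<open>
  The least positive member divides all the others, so a prime factor of it would divide every
  member.
\<close>

lemma one_mem_of_prime_avoiding: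
  fixes I :: "nat set"
  assumes diff: "\<And>a b. a \<in> I \<Longrightarrow> b \<in> I \<Longrightarrow> b \<le> a \<Longrightarrow> a - b \<in> I"
    and avoid: "\<And>p. Factorial_Ring.prime p \<Longrightarrow> \<exists>m\<in>I. \<not> p dvd m"
  shows "1 \<in> I"
proof -
  obtain m where m: "m \<in> I" "\<not> 2 dvd m"
    using avoid two_is_prime_nat by blast
  then have "m > 0" by (auto intro: gr0I)
  define d where "d = (LEAST d. d \<in> I \<and> d > 0)"
  have d: "d \<in> I" "d > 0"
    unfolding d_def using LeastI[of "\<lambda>d. d \<in> I \<and> d > 0" m] m \<open>m > 0\<close> by auto
  have least: "k = 0" if "k \<in> I" "k < d" for k
    using not_less_Least[of k "\<lambda>d. d \<in> I \<and> d > 0"] that unfolding d_def by auto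
  have "d dvd k" if "k \<in> I" for k
    using that
  proof (induction k rule: less_induct)
    case (less k)
    show ?case
    proof (cases "k < d")
      case True
      then show ?thesis using least less.prems by auto
    next
      case False
      then have "k - d \<in> I" "k - d < k"
        using diff less.prems d by auto
      then have "d dvd k - d" using less.IH by blast
      then show ?thesis using False by (simp add: dvd_diff_nat dvd_minus_self)
    qed
  qed
  then have "d = 1"
    using avoid prime_factor_nat[of d] by (metis dvd_trans)
  then show ?thesis using d by simp
qed

section \<open>Crossed homomorphisms into an abelian normal subgroup\<close>

locale abelian_normal_subgroup = normal N G for N and G (structure) +
  assumes N_comm: "m \<in> N \<Longrightarrow> n \<in> N \<Longrightarrow> m \<otimes> n = n \<otimes> m"
begin

text \<open>
  Viewing \<open>N\<close> as a commutative group of its own makes finite products over \<open>N\<close> and rearrangement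
  modulo commutativity available.
\<close>

sublocale A: comm_group "G\<lparr>carrier := N\<rparr>"
  rewrites "carrier (G\<lparr>carrier := N\<rparr>) = N"
    and "monoid.mult (G\<lparr>carrier := N\<rparr>) = monoid.mult G"
    and "monoid.one (G\<lparr>carrier := N\<rparr>) = \<one>"
proof -
  show "comm_group (G\<lparr>carrier := N\<rparr>)"
    by (rule group.group_comm_groupI) (use subgroup_is_group[OF is_group] N_comm in auto)
qed simp_all

definition act :: "'a \<Rightarrow> 'a \<Rightarrow> 'a" where
  "act x n = x \<otimes> n \<otimes> inv x"

definition crossed_hom :: "('a \<Rightarrow> 'a) \<Rightarrow> bool" where
  "crossed_hom f \<longleftrightarrow> f \<in> carrier G \<rightarrow> N \<and>
     (\<forall>x\<in>carrier G. \<forall>y\<in>carrier G. f (x \<otimes> y) = f x \<otimes> act x (f y))"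

definition principal_crossed_hom :: "('a \<Rightarrow> 'a) \<Rightarrow> bool" where
  "principal_crossed_hom f \<longleftrightarrow> (\<exists>n\<in>N. \<forall>x\<in>carrier G. f x = n \<otimes> inv (act x n))"

lemma act_closed [simp]: "x \<in> carrier G \<Longrightarrow> n \<in> N \<Longrightarrow> act x n \<in> N"
  unfolding act_def by (rule inv_op_closed2)

lemma act_mult: "x \<in> carrier G \<Longrightarrow> m \<in> N \<Longrightarrow> n \<in> N \<Longrightarrow> act x (m \<otimes> n) = act x m \<otimes> act x n"
  unfolding act_def by (simp add: m_assoc inv_solve_left)

lemma act_one [simp]: "x \<in> carrier G \<Longrightarrow> act x \<one> = \<one>"
  unfolding act_def by simp

lemma act_inv: "x \<in> carrier G \<Longrightarrow> n \<in> N \<Longrightarrow> act x (inv n) = inv (act x n)"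
  unfolding act_def by (simp add: m_assoc inv_mult_group)

lemma act_pow: "x \<in> carrier G \<Longrightarrow> n \<in> N \<Longrightarrow> act x (n [^] (k::nat)) = act x n [^] k"
  by (induction k) (simp_all add: act_mult nat_pow_consistent[of _ _ N] A.nat_pow_closed)

lemma act_act: "x \<in> carrier G \<Longrightarrow> y \<in> carrier G \<Longrightarrow> n \<in> N \<Longrightarrow> act (x \<otimes> y) n = act x (act y n)"
  unfolding act_def by (simp add: m_assoc inv_mult_group)

lemma act_trivial: "m \<in> N \<Longrightarrow> n \<in> N \<Longrightarrow> act m n = n"
  unfolding act_def by (simp add: N_comm[of m n] m_assoc)

lemma pow_closed [simp]: "n \<in> N \<Longrightarrow> n [^] (k::nat) \<in> N"
  by (induction k) auto

lemma pow_mult_N: "m \<in> N \<Longrightarrow> n \<in> N \<Longrightarrow> (m \<otimes> n) [^] (k::nat) = m [^] k \<otimes> n [^] k"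
  by (intro pow_mult_distrib) (auto simp: N_comm)


lemma act_carrier [simp]: "x \<in> carrier G \<Longrightarrow> n \<in> N \<Longrightarrow> act x n \<in> carrier G"
  using act_closed mem_carrier by blast

lemma inv_mult_N: "m \<in> N \<Longrightarrow> n \<in> N \<Longrightarrow> inv (m \<otimes> n) = inv m \<otimes> inv n"
  by (simp add: inv_mult_group N_comm)

lemma crossed_homI:
  assumes "\<And>x. x \<in> carrier G \<Longrightarrow> f x \<in> N"
    and "\<And>x y. x \<in> carrier G \<Longrightarrow> y \<in> carrier G \<Longrightarrow> f (x \<otimes> y) = f x \<otimes> act x (f y)"
  shows "crossed_hom f"
  using assms unfolding crossed_hom_def by auto

lemma crossed_hom_closed: "crossed_hom f \<Longrightarrow> x \<in> carrier G \<Longrightarrow> f x \<in> N"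
  unfolding crossed_hom_def by auto

lemma crossed_hom_mult:
  "crossed_hom f \<Longrightarrow> x \<in> carrier G \<Longrightarrow> y \<in> carrier G \<Longrightarrow> f (x \<otimes> y) = f x \<otimes> act x (f y)"
  unfolding crossed_hom_def by auto

lemma crossed_hom_one:
  assumes "crossed_hom f"
  shows "f \<one> = \<one>"
proof -
  have "f \<one> = f \<one> \<otimes> f \<one>"
    using crossed_hom_mult[OF assms, of \<one> \<one>] crossed_hom_closed[OF assms, of \<one>]
    by (simp add: act_trivial)
  then show ?thesis
    using crossed_hom_closed[OF assms, of \<one>] by (metis one_closed mem_carrier r_cancel_one)
qed

lemma crossed_hom_prod:
  assumes "crossed_hom f" "crossed_hom g"
  shows "crossed_hom (\<lambda>x. f x \<otimes> g x)"
  using assms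
  by (intro crossed_homI)
    (simp_all add: crossed_hom_closed crossed_hom_mult act_mult A.m_ac)

lemma crossed_hom_inv:
  assumes "crossed_hom f"
  shows "crossed_hom (\<lambda>x. inv (f x))"
  using assms
  by (intro crossed_homI)
    (simp_all add: crossed_hom_closed crossed_hom_mult act_inv inv_mult_N)

lemma crossed_hom_pow:
  assumes "crossed_hom f"
  shows "crossed_hom (\<lambda>x. f x [^] (k::nat))"
  using assms
  by (intro crossed_homI)
    (simp_all add: crossed_hom_closed crossed_hom_mult act_pow pow_mult_N)

lemma crossed_hom_principal:
  assumes "n \<in> N"
  shows "crossed_hom (\<lambda>x. n \<otimes> inv (act x n))"
proof (rule crossed_homI)
  fix x y assume xy: "x \<in> carrier G" "y \<in> carrier G"
  have "n \<otimes> inv (act x n) \<otimes> act x (n \<otimes> inv (act y n))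
      = n \<otimes> (inv (act x n) \<otimes> act x n) \<otimes> inv (act x (act y n))"
    using assms xy by (simp add: act_mult act_inv m_assoc mem_carrier)
      (simp add: m_assoc[symmetric] mem_carrier)
  then show "n \<otimes> inv (act (x \<otimes> y) n) = n \<otimes> inv (act x n) \<otimes> act x (n \<otimes> inv (act y n))"
    using assms xy by (simp add: act_act mem_carrier)
qed (use assms in simp)

lemma principal_prod:
  assumes "principal_crossed_hom f" "principal_crossed_hom g"
  shows "principal_crossed_hom (\<lambda>x. f x \<otimes> g x)"
proof -
  obtain m n where "m \<in> N" "\<forall>x\<in>carrier G. f x = m \<otimes> inv (act x m)"
    and "n \<in> N" "\<forall>x\<in>carrier G. g x = n \<otimes> inv (act x n)"
    using assms unfolding principal_crossed_hom_def by auto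
  then show ?thesis
    unfolding principal_crossed_hom_def
    by (intro bexI[of _ "m \<otimes> n"]) (simp_all add: act_mult inv_mult_N A.m_ac)
qed

lemma principal_inv:
  assumes "principal_crossed_hom f"
  shows "principal_crossed_hom (\<lambda>x. inv (f x))"
proof -
  obtain n where "n \<in> N" "\<forall>x\<in>carrier G. f x = n \<otimes> inv (act x n)"
    using assms unfolding principal_crossed_hom_def by auto
  then show ?thesis
    unfolding principal_crossed_hom_def
    by (intro bexI[of _ "inv n"]) (simp_all add: act_inv inv_mult_N)
qed

lemma principal_pow:
  assumes "principal_crossed_hom f"
  shows "principal_crossed_hom (\<lambda>x. f x [^] (k::nat))"
proof (induction k)
  case 0
  show ?case
    unfolding principal_crossed_hom_def by (intro bexI[of _ \<one>]) simp_all
next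
  case (Suc k)
  then show ?case
    using principal_prod[OF Suc assms] by simp
qed

lemma principal_cong:
  assumes "principal_crossed_hom f" "\<And>x. x \<in> carrier G \<Longrightarrow> f x = g x"
  shows "principal_crossed_hom g"
  using assms unfolding principal_crossed_hom_def by auto

lemma subgroup_kernel:
  assumes "crossed_hom f" "subgroup S G"
  shows "subgroup {x \<in> S. f x = \<one>} G"
proof (rule subgroupI)
  show "{x \<in> S. f x = \<one>} \<subseteq> carrier G"
    using assms(2) subgroup.subset by auto
  show "{x \<in> S. f x = \<one>} \<noteq> {}"
    using assms crossed_hom_one subgroup.one_closed by fastforce
next
  fix x assume "x \<in> {x \<in> S. f x = \<one>}"
  then have x: "x \<in> S" "x \<in> carrier G" "f x = \<one>"
    using subgroup.mem_carrier[OF assms(2)] by auto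
  have "f (inv x \<otimes> x) = f (inv x) \<otimes> act (inv x) (f x)"
    using x by (intro crossed_hom_mult[OF assms(1)]) auto
  then have "f (inv x) = \<one>"
    using x crossed_hom_one[OF assms(1)] crossed_hom_closed[OF assms(1), of "inv x"] by simp
  then show "inv x \<in> {x \<in> S. f x = \<one>}"
    using x subgroup.m_inv_closed[OF assms(2)] by simp
next
  fix x y assume "x \<in> {x \<in> S. f x = \<one>}" "y \<in> {x \<in> S. f x = \<one>}"
  then show "x \<otimes> y \<in> {x \<in> S. f x = \<one>}"
    using assms subgroup.m_closed[OF assms(2)] subgroup.mem_carrier[OF assms(2)]
    by (auto simp: crossed_hom_mult)
qed

section \<open>Multiplying over the cosets of the kernel\<close>

text \<open>
  A crossed homomorphism takes equal values at two elements exactly when they lie in the same left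
  coset of its kernel, so the image parametrises these cosets and its size is the index.
\<close>

lemma card_image_crossed_hom:
  assumes f: "crossed_hom f" and fin: "finite (carrier G)"
  shows "card (f ` carrier G) * card {x \<in> carrier G. f x = \<one>} = order G"
proof -
  let ?H = "{x \<in> carrier G. f x = \<one>}"
  have fibre: "card {x \<in> carrier G. f x = f y} = card ?H" if y: "y \<in> carrier G" for y
  proof -
    have eq: "f (y \<otimes> x) = f y \<longleftrightarrow> f x = \<one>" if "x \<in> carrier G" for x
    proof -
      have "f (y \<otimes> x) = f y \<longleftrightarrow> act y (f x) = \<one>"
        using that y crossed_hom_closed[OF f] by (simp add: crossed_hom_mult[OF f] mem_carrier)
      also have "\<dots> \<longleftrightarrow> f x = \<one>"
      proof
        assume "act y (f x) = \<one>"
        then have "act (inv y) (act y (f x)) = \<one>"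
          using y by simp
        then show "f x = \<one>"
          using that y crossed_hom_closed[OF f]
          by (simp add: act_act[symmetric] act_trivial)
      qed (use y in simp)
      finally show ?thesis .
    qed
    have "{x \<in> carrier G. f x = f y} = (\<lambda>x. y \<otimes> x) ` ?H"
    proof (intro equalityI subsetI)
      fix x assume x: "x \<in> {x \<in> carrier G. f x = f y}"
      then have "x = y \<otimes> (inv y \<otimes> x)"
        using y by (simp add: m_assoc[symmetric])
      then show "x \<in> (\<lambda>x. y \<otimes> x) ` ?H"
        using x y eq[of "inv y \<otimes> x"] by (intro image_eqI[of _ _ "inv y \<otimes> x"]) auto
    qed (use y eq in auto)
    moreover have "inj_on (\<lambda>x. y \<otimes> x) ?H"
      using y by (auto intro: inj_onI)
    ultimately show ?thesis
      by (simp add: card_image)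
  qed
  have "order G = (\<Sum>z\<in>f ` carrier G. card {x \<in> carrier G. f x = z})"
    using sum.image_gen[OF fin, of "\<lambda>_. 1::nat" f] by (simp add: order_def)
  also have "\<dots> = (\<Sum>z\<in>f ` carrier G. card ?H)"
    using fibre by (intro sum.cong) auto
  finally show ?thesis by simp
qed

lemma act_finprod:
  assumes x: "x \<in> carrier G" and "V \<subseteq> N"
  shows "act x (finprod (G\<lparr>carrier := N\<rparr>) (\<lambda>z. z) V) = finprod (G\<lparr>carrier := N\<rparr>) (act x) V"
  using assms(2)
proof (induction V rule: infinite_finite_induct)
  case (insert a V)
  then have "(\<lambda>z. z) \<in> V \<rightarrow> N" "act x \<in> V \<rightarrow> N"
    using x by auto
  then show ?case
    using insert x by (simp add: act_mult)
qed (use x in simp_all)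

text \<open>
  Let \<open>n\<close> be the product of all values of \<open>f\<close>, one factor for each coset of the kernel.
  The identity \<open>f (x y) = f x \<cdot> act x (f y)\<close> says that \<open>z \<mapsto> f x \<cdot> act x z\<close> maps the set of values
  to itself, and this map is injective.  Reindexing the product by it gives
  \<open>n = (f x)\<^sup>i \<cdot> act x n\<close> with \<open>i\<close> the number of values, which is the required equation.
\<close>

lemma principal_pow_card_image:
  assumes f: "crossed_hom f" and fin: "finite (carrier G)"
  shows "principal_crossed_hom (\<lambda>x. f x [^] card (f ` carrier G))"
proof -
  let ?V = "f ` carrier G" and ?A = "G\<lparr>carrier := N\<rparr>"
  define n where "n = finprod ?A (\<lambda>z. z) ?V"
  have V: "?V \<subseteq> N" "finite ?V"
    using crossed_hom_closed[OF f] fin by auto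
  have n: "n \<in> N"
    unfolding n_def using V by (intro A.finprod_closed) auto
  have "f x [^] card ?V = n \<otimes> inv (act x n)" if x: "x \<in> carrier G" for x
  proof -
    have fx: "f x \<in> N" using crossed_hom_closed[OF f x] .
    let ?t = "\<lambda>z. f x \<otimes> act x z"
    have inj: "inj_on ?t ?V"
    proof (rule inj_onI)
      fix y z assume yz: "y \<in> ?V" "z \<in> ?V" "?t y = ?t z"
      then have "y \<in> N" "z \<in> N" using V by auto
      then show "y = z"
        using yz(3) fx x unfolding act_def by (simp add: mem_carrier)
    qed
    have "?t ` ?V \<subseteq> ?V"
      using x by (auto simp: crossed_hom_mult[OF f, symmetric])
    then have perm: "?t ` ?V = ?V"
      using inj V(2) by (simp add: endo_inj_surj)
    have "n = finprod ?A (\<lambda>z. z) (?t ` ?V)"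
      unfolding perm n_def ..
    also have "\<dots> = finprod ?A ?t ?V"
      using V fx x inj by (intro A.finprod_reindex) auto
    also have "\<dots> = finprod ?A (\<lambda>_. f x) ?V \<otimes> finprod ?A (act x) ?V"
      using V fx x by (intro A.finprod_multf) auto
    also have "finprod ?A (\<lambda>_. f x) ?V = f x [^] card ?V"
      using A.finprod_const[OF fx, of ?V] by (simp add: nat_pow_consistent[symmetric])
    also have "finprod ?A (act x) ?V = act x n"
      unfolding n_def by (rule act_finprod[OF x V(1), symmetric])
    finally show ?thesis
      using n fx x by (simp add: inv_solve_right mem_carrier)
  qed
  then show ?thesis
    unfolding principal_crossed_hom_def using n by blast
qed


section \<open>Complements as kernels\<close>

text \<open>
  Evaluate \<open>f\<close> in two ways at \<open>y g = g x\<close>, where \<open>y = g x g\<inverse>\<close>.  The element \<open>f g\<close> that witnesses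
  principality does not depend on \<open>x\<close>; this is how conjugation by an arbitrary element of \<open>G\<close>
  preserves the property of being principal on a subgroup.
\<close>

lemma crossed_hom_conjugate:
  assumes f: "crossed_hom f" and g: "g \<in> carrier G" and x: "x \<in> carrier G" "f x = \<one>"
  shows "f (g \<otimes> x \<otimes> inv g) = f g \<otimes> inv (act (g \<otimes> x \<otimes> inv g) (f g))"
proof -
  let ?y = "g \<otimes> x \<otimes> inv g"
  have y: "?y \<in> carrier G" "?y \<otimes> g = g \<otimes> x"
    using g x by (simp_all add: m_assoc)
  have "f ?y \<otimes> act ?y (f g) = f g"
    using crossed_hom_mult[OF f y(1) g] crossed_hom_mult[OF f g x(1)] y(2) x(2) g
      crossed_hom_closed[OF f g] by (simp add: mem_carrier)
  then show ?thesis
    using y(1) g crossed_hom_closed[OF f] by (metis act_carrier inv_solve_right mem_carrier)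
qed

text \<open>
  The factorisation is \<open>x = f x \<cdot> ((f x)\<inverse> x)\<close>: because \<open>f\<close> fixes \<open>N \<inter> S\<close> pointwise, the second factor
  lies in the kernel.
\<close>

lemma complement_kernel:
  assumes f: "crossed_hom f" and S: "subgroup S G"
    and into: "\<And>x. x \<in> S \<Longrightarrow> f x \<in> S" and id: "\<And>n. n \<in> N \<inter> S \<Longrightarrow> f n = n"
  shows "complement (G\<lparr>carrier := S\<rparr>) (N \<inter> S) {x \<in> S. f x = \<one>}"
  unfolding complement_def
proof (intro conjI)
  let ?C = "{x \<in> S. f x = \<one>}"
  note SG = subgroup.mem_carrier[OF S]
  show "subgroup ?C (G\<lparr>carrier := S\<rparr>)"
    by (rule subgroup_incl[OF subgroup_kernel[OF f S] S]) auto
  show "N \<inter> S \<inter> ?C = {\<one>\<^bsub>G\<lparr>carrier := S\<rparr>\<^esub>}"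
    using id subgroup.one_closed[OF S] crossed_hom_one[OF f] by fastforce
  show "carrier (G\<lparr>carrier := S\<rparr>) = (N \<inter> S) <#>\<^bsub>G\<lparr>carrier := S\<rparr>\<^esub> ?C"
  proof (intro equalityI subsetI)
    fix x assume "x \<in> carrier (G\<lparr>carrier := S\<rparr>)"
    then have x: "x \<in> S" "x \<in> carrier G" using SG by auto
    let ?n = "f x" and ?k = "inv (f x) \<otimes> x"
    have n: "?n \<in> N \<inter> S" "inv ?n \<in> N \<inter> S"
      using x into crossed_hom_closed[OF f] subgroup.m_inv_closed[OF S] by auto
    have "f ?k = inv ?n \<otimes> act (inv ?n) ?n"
      using n x by (simp add: crossed_hom_mult[OF f] id mem_carrier)
    then have "f ?k = \<one>"
      using n by (simp add: act_trivial mem_carrier)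
    then have "?k \<in> ?C"
      using n x subgroup.m_closed[OF S] by simp
    moreover have "x = ?n \<otimes> ?k"
      using n x by (simp add: m_assoc[symmetric] mem_carrier)
    ultimately show "x \<in> (N \<inter> S) <#>\<^bsub>G\<lparr>carrier := S\<rparr>\<^esub> ?C"
      using n unfolding set_mult_def by auto
  next
    fix x assume "x \<in> (N \<inter> S) <#>\<^bsub>G\<lparr>carrier := S\<rparr>\<^esub> ?C"
    then show "x \<in> carrier (G\<lparr>carrier := S\<rparr>)"
      using subgroup.m_closed[OF S] unfolding set_mult_def by auto
  qed
qed

text \<open>
  Here \<open>f\<close> is the projection \<open>n k \<mapsto> n\<close> along \<open>K\<close>.  It is a crossed homomorphism because
  \<open>(m k) (n l) = (m \<cdot> act k n) (k l)\<close> and because \<open>m k\<close> acts on \<open>N\<close> as \<open>k\<close> does, \<open>N\<close> being abelian.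
\<close>

lemma complement_is_kernel:
  assumes K: "complement G N K"
  obtains f where "crossed_hom f" "\<And>n. n \<in> N \<Longrightarrow> f n = n" "K = {x \<in> carrier G. f x = \<one>}"
proof -
  have KG: "subgroup K G" and split: "carrier G = N <#> K" and int: "N \<inter> K = {\<one>}"
    using K unfolding complement_def by auto
  note KC = subgroup.mem_carrier[OF KG]
  have uniq: "m = n" if "m \<in> N" "n \<in> N" "k \<in> K" "l \<in> K" "m \<otimes> k = n \<otimes> l" for m n k l
  proof -
    have "inv n \<otimes> m = l \<otimes> inv k"
      using that KC by (metis inv_closed inv_solve_left inv_solve_right m_assoc m_closed mem_carrier)
    moreover have "inv n \<otimes> m \<in> N" "l \<otimes> inv k \<in> K"
      using that subgroup.m_closed[OF KG] subgroup.m_inv_closed[OF KG] by auto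
    ultimately have "inv n \<otimes> m = \<one>"
      using int by auto
    then show "m = n"
      using that by (metis inv_closed inv_equality inv_inv mem_carrier)
  qed
  define f where "f x = (THE n. n \<in> N \<and> (\<exists>k\<in>K. x = n \<otimes> k))" for x
  have f_eq: "f (n \<otimes> k) = n" if "n \<in> N" "k \<in> K" for n k
    unfolding f_def using that uniq by (intro the_equality) blast+
  have ex: "\<exists>n\<in>N. \<exists>k\<in>K. x = n \<otimes> k" if "x \<in> carrier G" for x
    using that unfolding split set_mult_def by auto
  have "crossed_hom f"
  proof (rule crossed_homI)
    fix x assume "x \<in> carrier G"
    then obtain n k where "n \<in> N" "k \<in> K" "x = n \<otimes> k"
      using ex by blast
    then show "f x \<in> N" using f_eq by simp
  next
    fix x y assume "x \<in> carrier G" "y \<in> carrier G"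
    then obtain m k n l where x: "m \<in> N" "k \<in> K" "x = m \<otimes> k" and y: "n \<in> N" "l \<in> K" "y = n \<otimes> l"
      using ex by meson
    have "act x n = act k n"
      using x y KC by (simp add: act_act act_trivial mem_carrier)
    moreover have "x \<otimes> y = (m \<otimes> act k n) \<otimes> (k \<otimes> l)"
      using x y KC unfolding act_def by (simp add: m_assoc mem_carrier)
        (simp add: m_assoc[symmetric] mem_carrier)
    ultimately show "f (x \<otimes> y) = f x \<otimes> act x (f y)"
      using x y KC subgroup.m_closed[OF KG] by (simp add: f_eq)
  qed
  moreover have "f n = n" if "n \<in> N" for n
    using f_eq[OF that subgroup.one_closed[OF KG]] that by (simp add: mem_carrier)
  moreover have "K = {x \<in> carrier G. f x = \<one>}"
  proof (intro equalityI subsetI)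
    fix x assume "x \<in> K"
    then show "x \<in> {x \<in> carrier G. f x = \<one>}"
      using f_eq[of \<one> x] KC by simp
  next
    fix x assume "x \<in> {x \<in> carrier G. f x = \<one>}"
    then obtain n k where "n \<in> N" "k \<in> K" "x = n \<otimes> k" "f x = \<one>"
      using ex by blast
    then show "x \<in> K"
      using f_eq KC by simp
  qed
  ultimately show thesis using that by blast
qed

text \<open>
  If \<open>n\<close> witnesses that \<open>f g\<inverse>\<close> is principal, then \<open>g (n x n\<inverse>) = f x\<close> for all \<open>x\<close>, so conjugation
  by \<open>n\<close> carries the first kernel to the second.
\<close>

lemma conjugate_kernels:
  assumes f: "crossed_hom f" and g: "crossed_hom g"
    and f_id: "\<And>n. n \<in> N \<Longrightarrow> f n = n" and g_id: "\<And>n. n \<in> N \<Longrightarrow> g n = n"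
    and pr: "principal_crossed_hom (\<lambda>x. f x \<otimes> inv (g x))"
  shows "conjugate_in G {x \<in> carrier G. f x = \<one>} {x \<in> carrier G. g x = \<one>}"
proof -
  obtain n where n: "n \<in> N" "\<And>x. x \<in> carrier G \<Longrightarrow> f x \<otimes> inv (g x) = n \<otimes> inv (act x n)"
    using pr unfolding principal_crossed_hom_def by auto
  have conj: "f x = \<one> \<longleftrightarrow> g (n \<otimes> x \<otimes> inv n) = \<one>" if x: "x \<in> carrier G" for x
  proof -
    have fx: "f x \<in> N" and gx: "g x \<in> N"
      using x f g crossed_hom_closed by auto
    have "g (n \<otimes> x \<otimes> inv n) = n \<otimes> g x \<otimes> inv (act x n)"
      using n(1) x gx crossed_hom_mult[OF g] g_id
      by (simp add: act_act act_trivial act_inv act_mult mem_carrier)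
    also have "\<dots> = g x \<otimes> (n \<otimes> inv (act x n))"
      using n(1) x gx by (simp add: A.m_ac)
    also have "\<dots> = g x \<otimes> (f x \<otimes> inv (g x))"
      using n(2) x by simp
    also have "\<dots> = f x \<otimes> (g x \<otimes> inv (g x))"
      using fx gx by (intro A.m_lcomm) auto
    finally show ?thesis
      using fx gx by (simp add: mem_carrier)
  qed
  have "{x \<in> carrier G. g x = \<one>} = (n <# {x \<in> carrier G. f x = \<one>}) #> inv n"
  proof (intro equalityI subsetI)
    fix y assume y: "y \<in> {x \<in> carrier G. g x = \<one>}"
    let ?x = "inv n \<otimes> y \<otimes> n"
    have x: "?x \<in> carrier G" "y = n \<otimes> ?x \<otimes> inv n"
      using y n(1) by (simp_all add: mem_carrier m_assoc)
        (simp add: mem_carrier m_assoc[symmetric])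
    then have "f ?x = \<one>"
      using conj y by auto
    then show "y \<in> (n <# {x \<in> carrier G. f x = \<one>}) #> inv n"
      using x unfolding l_coset_def r_coset_def by blast
  next
    fix y assume "y \<in> (n <# {x \<in> carrier G. f x = \<one>}) #> inv n"
    then show "y \<in> {x \<in> carrier G. g x = \<one>}"
      using conj n(1) unfolding l_coset_def r_coset_def by (auto simp: mem_carrier)
  qed
  then show ?thesis
    unfolding conjugate_in_def using n(1) mem_carrier by blast
qed

section \<open>The contribution of a single prime\<close>

text \<open>
  The index \<open>a\<close> of \<open>N \<inter> S\<close> in \<open>N\<close> equals the index of \<open>S\<close> in \<open>N S\<close>, which is prime to \<open>p\<close> because \<open>S\<close>
  is a Sylow subgroup.  Raising to the power \<open>a\<close> sends \<open>N\<close> into \<open>N \<inter> S\<close>; a multiple \<open>e\<close> of \<open>a\<close> that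
  is also \<open>1\<close> modulo the order of \<open>S\<close> moreover fixes \<open>N \<inter> S\<close> pointwise.
\<close>

lemma sylow_power_projection:
  assumes fin: "finite (carrier G)" and p: "Factorial_Ring.prime p" and S: "sylow_subgroup G p S"
  obtains e :: nat where "\<not> p dvd e" "\<And>n. n \<in> N \<Longrightarrow> n [^] e \<in> S"
    "\<And>n. n \<in> N \<inter> S \<Longrightarrow> n [^] e = n"
proof -
  have SG: "subgroup S G" and cS: "card S = p ^ multiplicity p (order G)"
    using S unfolding sylow_subgroup_def by auto
  interpret snd: second_isomorphism_grp N G S
    by (intro second_isomorphism_grp.intro second_isomorphism_grp_axioms.intro normal_axioms SG)
  let ?GS = "G\<lparr>carrier := S\<rparr>" and ?T = "N <#> S"
  let ?GT = "G\<lparr>carrier := ?T\<rparr>" and ?GN = "G\<lparr>carrier := N\<rparr>"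
  have TG: "subgroup ?T G" by (rule snd.normal_set_mult_subgroup)
  interpret GS: group ?GS by (rule subgroup_imp_group[OF SG])
  interpret GT: group ?GT by (rule subgroup_imp_group[OF TG])
  have NS: "subgroup (N \<inter> S) G"
    using subgroups_Inter_pair is_subgroup SG by blast
  have finN: "finite N"
    using fin subset finite_subset by auto
  have subs: "subgroup (N \<inter> S) ?GN" "subgroup (N \<inter> S) ?GS" "subgroup S ?GT" "subgroup N ?GT"
    using subgroup_incl[OF NS is_subgroup] subgroup_incl[OF NS SG] subgroup_incl[OF SG TG]
      subgroup_incl[OF is_subgroup TG] snd.S_contained_in_set_mult snd.H_contained_in_set_mult by auto
  define a where "a = card (rcosets\<^bsub>?GN\<^esub> (N \<inter> S))"
  have lag_N: "a * card (N \<inter> S) = card N"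
    unfolding a_def using A.lagrange[OF subs(1)] by (simp add: order_def)
  have lag_S: "card (rcosets\<^bsub>?GS\<^esub> (N \<inter> S)) * card (N \<inter> S) = card S"
    using GS.lagrange[OF subs(2)] by (simp add: order_def)
  have lag_T: "card (rcosets\<^bsub>?GT\<^esub> N) * card N = card ?T"
    using GT.lagrange[OF subs(4)] by (simp add: order_def)
  have "card (rcosets\<^bsub>?GS\<^esub> (N \<inter> S)) = card (rcosets\<^bsub>?GT\<^esub> N)"
    using snd.normal_intersection_quotient_isom bij_betw_same_card
    unfolding iso_def FactGroup_def by fastforce
  then have "card (N \<inter> S) * card ?T = card (N \<inter> S) * (a * card S)"
    using lag_N lag_S lag_T by (metis mult.assoc mult.commute)
  moreover have "card (N \<inter> S) > 0"
    using finN subgroup.one_closed[OF NS] by (auto simp: card_gt_0_iff)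
  ultimately have "card ?T = a * card S" by simp
  moreover have "card ?T dvd order G"
    using lagrange[OF TG] by (metis dvd_triv_right)
  ultimately have dvd_G: "a * p ^ multiplicity p (order G) dvd order G"
    using cS by simp
  have pa: "\<not> p dvd a"
  proof
    assume "p dvd a"
    then have "p ^ Suc (multiplicity p (order G)) dvd order G"
      using dvd_G dvd_trans[OF mult_dvd_mono[OF _ dvd_refl]] by simp
    moreover have "order G \<noteq> 0"
      using fin by (simp add: order_gt_0_iff_finite[symmetric])
    ultimately show False
      using p by (metis multiplicity_geI Suc_n_not_le_n not_prime_unit power_dvd_iff_le_multiplicity)
  qed
  \<comment> \<open>The extra factor \<open>p\<close> keeps \<open>e\<close> prime to \<open>p\<close> also when \<open>S\<close> is trivial.\<close>
  define P where "P = p * card S"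
  have "coprime a P"
    using pa p cS unfolding P_def
    by (metis coprime_commute coprime_power_left_iff mult.commute power_Suc prime_imp_coprime)
  moreover have "a \<noteq> 0"
    using pa by (metis dvd_0_right)
  ultimately obtain b y where e: "a * b = P * y + 1"
    using bezout_nat[of a P] by auto
  let ?e = "a * b"
  show thesis
  proof (rule that[of ?e])
    show "\<not> p dvd ?e"
    proof
      assume "p dvd ?e"
      then have "p dvd 1"
        using e unfolding P_def by (metis dvd_add_right_iff dvd_mult2 dvd_triv_left)
      then show False using p by simp
    qed
  next
    fix n assume n: "n \<in> N"
    interpret Q: normal "N \<inter> S" ?GN
      using A.normal_iff_subgroup subs(1) by blast
    interpret QG: group "?GN Mod (N \<inter> S)"
      by (rule Q.factorgroup_is_group)
    let ?Q = "?GN Mod (N \<inter> S)" and ?n = "(N \<inter> S) #>\<^bsub>?GN\<^esub> n"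
    have order_Q: "order ?Q = a"
      by (simp add: order_def a_def FactGroup_def)
    have "?n \<in> carrier ?Q"
      using n by (auto simp: carrier_FactGroup)
    then have "?n [^]\<^bsub>?Q\<^esub> a = N \<inter> S"
      using QG.pow_order_eq_1 order_Q by fastforce
    then have "(N \<inter> S) #>\<^bsub>?GN\<^esub> (n [^]\<^bsub>?GN\<^esub> a) = N \<inter> S"
      using Q.FactGroup_pow[where a = n and k = a] n by simp
    then have "n [^] a \<in> N \<inter> S"
      using A.coset_join1[OF _ _ subs(1)] n by (simp add: nat_pow_consistent[symmetric])
    moreover have "m [^] k \<in> S" if "m \<in> S" for m and k :: nat
      using that subgroup.one_closed[OF SG] subgroup.m_closed[OF SG] by (induction k) auto
    ultimately have "(n [^] a) [^] b \<in> S" by blast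
    then show "n [^] ?e \<in> S"
      using n by (simp add: nat_pow_pow mem_carrier)
  next
    fix n assume n: "n \<in> N \<inter> S"
    then have nG: "n \<in> carrier G" by (simp add: mem_carrier)
    have "n [^] card S = \<one>"
      using GS.pow_order_eq_1[of n] n by (simp add: order_def nat_pow_consistent[symmetric])
    then have "n [^] (P * y) = \<one>"
      using nG unfolding P_def by (metis mult.commute mult.assoc nat_pow_one nat_pow_pow)
    then show "n [^] ?e = n"
      using nG by (subst e) (simp add: nat_pow_mult[symmetric])
  qed
qed

text \<open>
  With \<open>e\<close> as in the previous lemma, the conjugacy of the kernels of \<open>f\<^sup>e\<close> and \<open>g\<^sup>e\<close> on \<open>S\<close> makes
  \<open>(f g\<inverse>)\<^sup>e\<close> principal on a subgroup containing \<open>S\<close>.  Passing to all of \<open>G\<close> costs a further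
  factor in the exponent, the index of that subgroup.
\<close>

lemma sylow_power_principal:
  assumes fin: "finite (carrier G)" and p: "Factorial_Ring.prime p" and S: "sylow_subgroup G p S"
    and conj: "\<And>C D. complement (G\<lparr>carrier := S\<rparr>) (N \<inter> S) C \<Longrightarrow>
               complement (G\<lparr>carrier := S\<rparr>) (N \<inter> S) D \<Longrightarrow> conjugate_in G C D"
    and f: "crossed_hom f" and g: "crossed_hom g"
    and f_id: "\<And>n. n \<in> N \<Longrightarrow> f n = n" and g_id: "\<And>n. n \<in> N \<Longrightarrow> g n = n"
  obtains m :: nat where "\<not> p dvd m" "principal_crossed_hom (\<lambda>x. (f x \<otimes> inv (g x)) [^] m)"
proof -
  have SG: "subgroup S G" and cS: "card S = p ^ multiplicity p (order G)"
    using S unfolding sylow_subgroup_def by auto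
  note SC = subgroup.mem_carrier[OF SG]
  obtain e :: nat where e: "\<not> p dvd e" "\<And>n. n \<in> N \<Longrightarrow> n [^] e \<in> S"
    "\<And>n. n \<in> N \<inter> S \<Longrightarrow> n [^] e = n"
    using sylow_power_projection[OF fin p S] by blast
  let ?f = "\<lambda>x. f x [^] e" and ?g = "\<lambda>x. g x [^] e"
  let ?C = "{x \<in> S. ?f x = \<one>}" and ?D = "{x \<in> S. ?g x = \<one>}"
  have fe: "crossed_hom ?f" and ge: "crossed_hom ?g"
    using crossed_hom_pow f g by auto
  have "complement (G\<lparr>carrier := S\<rparr>) (N \<inter> S) ?C"
    using e f_id crossed_hom_closed[OF f] SC by (intro complement_kernel[OF fe SG]) auto
  moreover have D: "complement (G\<lparr>carrier := S\<rparr>) (N \<inter> S) ?D"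
    using e g_id crossed_hom_closed[OF g] SC by (intro complement_kernel[OF ge SG]) auto
  ultimately have "conjugate_in G ?C ?D"
    by (rule conj)
  then obtain c where c: "c \<in> carrier G" and D_eq: "?D = (c <# ?C) #> inv c"
    unfolding conjugate_in_def by auto
  define n where "n = ?f c"
  have n: "n \<in> N"
    unfolding n_def using c crossed_hom_closed[OF fe] by simp
  define h where "h x = (f x \<otimes> inv (g x)) [^] e" for x
  define q where "q x = n \<otimes> inv (act x n)" for x
  define t where "t x = h x \<otimes> inv (q x)" for x
  have h: "crossed_hom h"
    unfolding h_def using f g by (intro crossed_hom_pow crossed_hom_prod crossed_hom_inv)
  have q: "crossed_hom q" "principal_crossed_hom q"
    using crossed_hom_principal[OF n] n unfolding q_def principal_crossed_hom_def by auto
  have t: "crossed_hom t"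
    unfolding t_def using h q by (intro crossed_hom_prod crossed_hom_inv)
  \<comment> \<open>The subgroup on which \<open>h\<close> agrees with the principal crossed homomorphism \<open>q\<close>.\<close>
  let ?H = "{x \<in> carrier G. t x = \<one>}"
  have H: "subgroup ?H G"
    using subgroup_kernel[OF t subgroup_self] .
  have D_H: "?D \<subseteq> ?H"
  proof
    fix y assume y: "y \<in> ?D"
    then obtain x where x: "x \<in> ?C" "y = c \<otimes> x \<otimes> inv c"
      unfolding D_eq l_coset_def r_coset_def by auto
    have yG: "y \<in> carrier G" using y SC by auto
    \<comment> \<open>On \<open>D\<close> the factor \<open>g\<^sup>e\<close> vanishes, and \<open>f\<^sup>e\<close> is principal there since it vanishes on \<open>C\<close>.\<close>
    have "?f y = q y"
      using crossed_hom_conjugate[OF fe c, of x] x SC unfolding q_def n_def by auto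
    moreover have "h y = ?f y"
    proof -
      have "h y \<otimes> ?g y = (f y \<otimes> inv (g y) \<otimes> g y) [^] e"
        using yG crossed_hom_closed[OF f] crossed_hom_closed[OF g]
        unfolding h_def by (simp add: pow_mult_N)
      then show ?thesis
        using y yG crossed_hom_closed[OF f yG] crossed_hom_closed[OF g yG]
          crossed_hom_closed[OF h yG] by (simp add: m_assoc mem_carrier)
    qed
    ultimately show "y \<in> ?H"
      using yG crossed_hom_closed[OF q(1) yG] unfolding t_def by (simp add: mem_carrier)
  qed
  have N_H: "N \<subseteq> ?H"
    using n f_id g_id by (auto simp: t_def h_def q_def act_trivial mem_carrier)
  have S_split: "\<exists>k\<in>N. \<exists>y\<in>?D. x = k \<otimes> y" if "x \<in> S" for x
    using D that unfolding complement_def set_mult_def by simp blast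
  have S_H: "S \<subseteq> ?H"
  proof (intro subsetI)
    fix x assume "x \<in> S"
    then obtain k y where "k \<in> N" "y \<in> ?D" "x = k \<otimes> y"
      using S_split by blast
    then show "x \<in> ?H"
      using subgroup.m_closed[OF H, of k y] D_H N_H by blast
  qed
  define i where "i = card (t ` carrier G)"
  have "\<not> p dvd i"
  proof
    assume "p dvd i"
    have "card S dvd card ?H"
      using group.lagrange[OF subgroup_imp_group[OF H] subgroup_incl[OF SG H S_H]]
      by (simp add: order_def) (metis dvd_triv_right)
    then have "p * card S dvd i * card ?H"
      using \<open>p dvd i\<close> by (rule mult_dvd_mono[rotated])
    then have "p ^ Suc (multiplicity p (order G)) dvd order G"
      using card_image_crossed_hom[OF t fin] cS unfolding i_def by simp
    moreover have "order G \<noteq> 0"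
      using fin by (simp add: order_gt_0_iff_finite[symmetric])
    ultimately show False
      using p by (metis Suc_n_not_le_n not_prime_unit power_dvd_iff_le_multiplicity)
  qed
  then have "\<not> p dvd e * i"
    using e(1) p prime_dvd_mult_iff by blast
  moreover have "principal_crossed_hom (\<lambda>x. (f x \<otimes> inv (g x)) [^] (e * i))"
  proof (rule principal_cong)
    show "principal_crossed_hom (\<lambda>x. t x [^] i \<otimes> q x [^] i)"
      unfolding i_def
      by (intro principal_prod principal_pow principal_pow_card_image t fin q)
    fix x assume x: "x \<in> carrier G"
    have cl: "h x \<in> N" "q x \<in> N" "f x \<in> N" "g x \<in> N"
      using x h q(1) f g crossed_hom_closed by auto
    then have "t x [^] i \<otimes> q x [^] i = h x [^] i"
      unfolding t_def by (simp add: pow_mult_N[symmetric] m_assoc mem_carrier)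
    also have "\<dots> = (f x \<otimes> inv (g x)) [^] (e * i)"
      using cl unfolding h_def by (simp add: nat_pow_pow mem_carrier)
    finally show "t x [^] i \<otimes> q x [^] i = (f x \<otimes> inv (g x)) [^] (e * i)" .
  qed
  ultimately show thesis using that by blast
qed

section \<open>Conjugacy of complements\<close>

lemma conjugate_complements:
  assumes fin: "finite (carrier G)"
    and sylow: "\<And>p :: nat. Factorial_Ring.prime p \<Longrightarrow>
      \<exists>S. sylow_subgroup G p S \<and>
        (\<forall>K L. complement (G\<lparr>carrier := S\<rparr>) (N \<inter> S) K \<and>
               complement (G\<lparr>carrier := S\<rparr>) (N \<inter> S) L \<longrightarrow> conjugate_in G K L)"
    and K: "complement G N K" and L: "complement G N L"
  shows "conjugate_in G K L"
proof -
  obtain f where f: "crossed_hom f" "\<And>n. n \<in> N \<Longrightarrow> f n = n" "K = {x \<in> carrier G. f x = \<one>}"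
    using complement_is_kernel[OF K] by blast
  obtain g where g: "crossed_hom g" "\<And>n. n \<in> N \<Longrightarrow> g n = n" "L = {x \<in> carrier G. g x = \<one>}"
    using complement_is_kernel[OF L] by blast
  define d where "d x = f x \<otimes> inv (g x)" for x
  have d: "d x \<in> N" if "x \<in> carrier G" for x
    using that f g crossed_hom_closed unfolding d_def by simp
  let ?I = "{m :: nat. principal_crossed_hom (\<lambda>x. d x [^] m)}"
  have "1 \<in> ?I"
  proof (rule one_mem_of_prime_avoiding)
    fix a b assume ab: "a \<in> ?I" "b \<in> ?I" "b \<le> a"
    have "principal_crossed_hom (\<lambda>x. d x [^] a \<otimes> inv (d x [^] b))"
      using ab by (intro principal_prod principal_inv) auto
    moreover have "d x [^] a \<otimes> inv (d x [^] b) = d x [^] (a - b)" if "x \<in> carrier G" for x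
    proof -
      have "d x [^] a = d x [^] (a - b) \<otimes> d x [^] b"
        using ab(3) d[OF that] by (simp add: nat_pow_mult mem_carrier)
      then show ?thesis
        using d[OF that] by (simp add: m_assoc mem_carrier)
    qed
    ultimately have "principal_crossed_hom (\<lambda>x. d x [^] (a - b))"
      by (rule principal_cong)
    then show "a - b \<in> ?I" by simp
  next
    fix p :: nat assume p: "Factorial_Ring.prime p"
    then obtain S where S: "sylow_subgroup G p S"
      and conj: "\<And>K L. complement (G\<lparr>carrier := S\<rparr>) (N \<inter> S) K \<Longrightarrow>
             complement (G\<lparr>carrier := S\<rparr>) (N \<inter> S) L \<Longrightarrow> conjugate_in G K L"
      using sylow by meson
    obtain m :: nat where "\<not> p dvd m" "principal_crossed_hom (\<lambda>x. (f x \<otimes> inv (g x)) [^] m)"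
      by (rule sylow_power_principal[OF fin p S conj f(1) g(1) f(2) g(2)])
    then show "\<exists>m\<in>?I. \<not> p dvd m"
      unfolding d_def by auto
  qed
  then have "principal_crossed_hom (\<lambda>x. d x [^] (1::nat))" by simp
  then have "principal_crossed_hom (\<lambda>x. f x \<otimes> inv (g x))"
    by (rule principal_cong) (use d in \<open>simp add: d_def mem_carrier\<close>)
  then show ?thesis
    using conjugate_kernels[OF f(1) g(1) f(2) g(2)] f(3) g(3) by simp
qed

end

theorem corollary1:
  fixes G :: "('a, 'b) monoid_scheme" and N :: "'a set"
  assumes "group G" and "finite (carrier G)"
    and "N \<lhd> G" and "comm_group (G\<lparr>carrier := N\<rparr>)"
    and "\<exists>K. complement G N K"
    and "\<And>p :: nat. Factorial_Ring.prime p \<Longrightarrow>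
      \<exists>S. sylow_subgroup G p S \<and>
        (\<forall>K L. complement (G\<lparr>carrier := S\<rparr>) (N \<inter> S) K \<and>
               complement (G\<lparr>carrier := S\<rparr>) (N \<inter> S) L \<longrightarrow> conjugate_in G K L)"
  shows "\<forall>K L. complement G N K \<and> complement G N L \<longrightarrow> conjugate_in G K L"
proof -
  interpret N: normal N G by (rule assms(3))
  interpret abelian_normal_subgroup N G
    by unfold_locales (use comm_monoid.m_comm[OF comm_group.axioms(1)[OF assms(4)]] in auto)
  show ?thesis
    using conjugate_complements[OF assms(2,6)] by blast
qed

end
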